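(* Let $m\ge 1$, let $B=\{B_1,\dots,B_l\}$ be a group structure on $M=\{1,\dots,m\}$, and let $f:\mathbb{R}^m\to\mathbb{R}$ belong to $\mathcal F$. GShap attributions are invariant under any invertible group transformation: for every group $B_i$, every invertible group transformation $\mathbf q$ acting on the group $B_i$, and all $\overline{\mathbf x},\mathbf x'$ in the domain of $\mathbf q$, $$\mathrm{GS}_{B_k}(\overline{\mathbf x},\mathbf x',f)=\mathrm{GS}_{B_k}\bigl(\mathbf q(\overline{\mathbf x}),\mathbf q(\mathbf x'),f\circ\mathbf q^{-1}\bigr)\qquad\text{for all } k\in\{1,\dots,l\}.$$
   Context: $\mathcal F$ is the class of functions $f:\mathbb{R}^m\to\mathbb{R}$ that are differentiable almost everywhere (the formula for GShap below makes sense for any function defined at the points where it is evaluated). A group structure on $M=\{1,\dots,m\}$ is a partition $B=\{B_1,\dots,B_l\}$ of $M$ into pairwise disjoint nonempty sets with union $M$. Put $L=\{1,\dots,l\}$. For $S\subseteq M$, $v(\overline{\mathbf x},\mathbf x',f;S)=f(\overline{\mathbf x}_S;\mathbf x'_{M\setminus S})$ is the value of $f$ at the point whose $j$-th coordinate is $\overline x_j$ if $j\in S$ and $x'_j$ if $j\notin S$. For $T\subseteq L$, $v_B(\overline{\mathbf x},\mathbf x',f;T)=v(\overline{\mathbf x},\mathbf x',f;\bigcup_{k\in T}B_k)$. Group baseline Shapley (GShap): for $i\in L$, $$\mathrm{GS}_{B_i}(\overline{\mathbf x},\mathbf x',f)=\sum_{T\subseteq L\setminus\{i\}}\frac{|T|!\,(l-|T|-1)!}{l!}\bigl(v_B(\overline{\mathbf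 x},\mathbf x',f;T\cup\{i\})-v_B(\overline{\mathbf x},\mathbf x',f;T)\bigr).$$ Write $\mathbf x=(\mathbf x_{B_i},\mathbf x_\neg)$, where $\mathbf x_\neg$ collects the coordinates outside $B_i$. An invertible group transformation acting on $B_i$ is a map $\mathbf q(\mathbf x)=(\mathbf q_{0}(\mathbf x_{B_i}),\mathbf x_\neg)$, where $\mathbf q_0:U\to V$ is a bijection between subsets $U,V\subseteq\mathbb{R}^{B_i}$; its domain is the set of $\mathbf x$ with $\mathbf x_{B_i}\in U$ ($U=V=\mathbb{R}^{B_i}$ is allowed). The function $f\circ\mathbf q^{-1}$ is defined at all points whose $B_i$-part lies in $V$. *)

theory Defs
  imports "HOL-Analysis.Analysis"
begin

text \<open>The coordinate set $M$ is the universe of a finite type \<open>'m\<close>, so $m$ = \<open>CARD('m)\<close> \<open>\<ge> 1\<close>.\<close>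

definition ae_differentiable :: "(real ^ 'm::finite \<Rightarrow> real) \<Rightarrow> bool" where
  "ae_differentiable f \<longleftrightarrow> (AE x in lebesgue. f differentiable (at x))"

text \<open>The groups of the partition are indexed by \<open>{1..l}\<close>; values of \<open>B\<close> elsewhere are irrelevant.\<close>

definition group_structure :: "nat \<Rightarrow> (nat \<Rightarrow> 'm::finite set) \<Rightarrow> bool" where
  "group_structure l B \<longleftrightarrow>
     (\<forall>k\<in>{1..l}. B k \<noteq> {}) \<and> disjoint_family_on B {1..l} \<and> (\<Union>k\<in>{1..l}. B k) = UNIV"

definition val ::
  "real ^ 'm::finite \<Rightarrow> real ^ 'm \<Rightarrow> (real ^ 'm \<Rightarrow> real) \<Rightarrow> 'm set \<Rightarrow> real" where
  "val xbar x' f S = f (\<chi> j. if j \<in> S then xbar $ j else x' $ j)"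

definition group_val ::
  "(nat \<Rightarrow> 'm::finite set) \<Rightarrow> real ^ 'm \<Rightarrow> real ^ 'm \<Rightarrow> (real ^ 'm \<Rightarrow> real) \<Rightarrow> nat set \<Rightarrow> real" where
  "group_val B xbar x' f T = val xbar x' f (\<Union>k\<in>T. B k)"

definition GShap ::
  "nat \<Rightarrow> (nat \<Rightarrow> 'm::finite set) \<Rightarrow> nat \<Rightarrow> real ^ 'm \<Rightarrow> real ^ 'm \<Rightarrow> (real ^ 'm \<Rightarrow> real) \<Rightarrow> real" where
  "GShap l B i xbar x' f =
     (\<Sum>T\<in>Pow ({1..l} - {i}).
        fact (card T) * fact (l - card T - 1) / fact l *
        (group_val B xbar x' f (T \<union> {i}) - group_val B xbar x' f T))"

text \<open>
  The space $R^G$ of vectors indexed by a set \<open>G\<close> of coordinates is \<open>G \<rightarrow>\<^sub>E UNIV\<close>: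
  functions that are \<open>undefined\<close> outside \<open>G\<close>.
\<close>

definition block :: "'m set \<Rightarrow> real ^ 'm::finite \<Rightarrow> ('m \<Rightarrow> real)" where
  "block G x = restrict (\<lambda>j. x $ j) G"

text \<open>
  \<open>q\<close> is a map with domain \<open>D\<close>. As a HOL function it is total, but nothing is
  required of its values outside \<open>D\<close>.
\<close>

definition invertible_group_transformation ::
  "'m::finite set \<Rightarrow> (real ^ 'm) set \<Rightarrow> (real ^ 'm \<Rightarrow> real ^ 'm) \<Rightarrow> bool" where
  "invertible_group_transformation G D q \<longleftrightarrow>
     (\<exists>q0 U V.
        U \<subseteq> (G \<rightarrow>\<^sub>E UNIV) \<and> V \<subseteq> (G \<rightarrow>\<^sub>E UNIV) \<and> bij_betw q0 U V \<and>
        D = {x. block G x \<in> U} \<and>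
        (\<forall>x\<in>D. q x = (\<chi> j. if j \<in> G then q0 (block G x) j else x $ j)))"

end

theory Submission
  imports Defs
begin

text \<open>
  A union of groups either contains or misses the transformed group, so the hybrid point
  of \<open>xbar\<close> and \<open>x'\<close> along such a union stays in the domain of \<open>q\<close>, and \<open>q\<close> maps it to the
  corresponding hybrid of \<open>q xbar\<close> and \<open>q x'\<close>. As \<open>q\<close> is injective on its domain, all
  coalition values agree, and hence so do the attributions.
\<close>

text \<open>A point is determined by its block on \<open>G\<close> and its coordinates off
  \<open>G\<close>; \<open>q\<close> keeps the latter and acts on the former by \<open>q0\<close>,
  which is injective on \<open>U\<close>.\<close>

lemma invertible_group_transformation_inj_on:
  assumes "invertible_group_transformation G D q"
  shows "inj_on q D"
proof (rule inj_onI)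
  fix x y assume x: "x \<in> D" and y: "y \<in> D" and eq: "q x = q y"
  obtain q0 U V where V: "V \<subseteq> (G \<rightarrow>\<^sub>E UNIV)" and bij: "bij_betw q0 U V"
    and D: "D = {x. block G x \<in> U}"
    and q: "\<forall>x\<in>D. q x = (\<chi> j. if j \<in> G then q0 (block G x) j else x $ j)"
    using assms unfolding invertible_group_transformation_def by blast
  have coord: "(if j \<in> G then q0 (block G x) j else x $ j)
      = (if j \<in> G then q0 (block G y) j else y $ j)" for j
    using eq q x y by (simp add: vec_eq_iff)
  \<comment> \<open>Equality of \<open>q x\<close> and \<open>q y\<close> compares the
    \<open>q0\<close> values only on \<open>G\<close>. Off \<open>G\<close> both are
    \<open>undefined\<close>, so agreement on \<open>G\<close> makes them equal as
    functions.\<close>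
  have "q0 u \<in> G \<rightarrow>\<^sub>E UNIV" if "u \<in> U" for u
    using bij_betwE[OF bij] V that by blast
  moreover have U: "block G x \<in> U" "block G y \<in> U"
    using x y D by auto
  moreover have "q0 (block G x) j = q0 (block G y) j" if "j \<in> G" for j
    using coord[of j] that by simp
  ultimately have "q0 (block G x) = q0 (block G y)"
    by (meson PiE_ext)
  then have blk: "block G x = block G y"
    using bij U by (meson bij_betw_def inj_onD)
  have "x $ j = y $ j" for j
  proof (cases "j \<in> G")
    case True
    then show ?thesis using fun_cong[OF blk, of j] by (simp add: block_def)
  next
    case False
    then show ?thesis using coord[of j] by simp
  qed
  then show "x = y"
    by (simp add: vec_eq_iff)
qed

text \<open>\<open>q0\<close> acts on the block as a whole, so a set \<open>S\<close> cutting
  \<open>G\<close> could mix two blocks and leave \<open>U\<close>. Under \<open>S\<close>'s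
  dichotomy the block of \<open>z\<close> comes from a single point.\<close>

lemma invertible_group_transformation_hybrid:
  assumes "invertible_group_transformation G D q" and "x \<in> D" and "y \<in> D"
    and S: "G \<subseteq> S \<or> G \<inter> S = {}"
  defines "z \<equiv> \<chi> j. if j \<in> S then x $ j else y $ j"
  shows "z \<in> D" and "q z = (\<chi> j. if j \<in> S then q x $ j else q y $ j)"
proof -
  obtain q0 U where D: "D = {x. block G x \<in> U}"
    and q: "\<forall>x\<in>D. q x = (\<chi> j. if j \<in> G then q0 (block G x) j else x $ j)"
    using assms(1) unfolding invertible_group_transformation_def by blast
  have blk: "block G z = (if G \<subseteq> S then block G x else block G y)"
    using S by (auto simp: block_def z_def restrict_def fun_eq_iff)
  then show zD: "z \<in> D"
    using assms(2,3) D by simp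
  have "q z $ j = (if j \<in> S then q x $ j else q y $ j)" for j
  proof (cases "j \<in> G")
    case True
    \<comment> \<open>For \<open>j\<close> in \<open>G\<close>, membership in \<open>S\<close> is
      equivalent to \<open>G \<subseteq> S\<close>, so the case split in \<open>blk\<close> matches
      the one in the goal.\<close>
    then show ?thesis
      using S zD assms(2,3) q blk by auto
  next
    case False
    then show ?thesis
      using zD assms(2,3) q by (simp add: z_def)
  qed
  then show "q z = (\<chi> j. if j \<in> S then q x $ j else q y $ j)"
    by (simp add: vec_eq_iff)
qed

text \<open>The hybrid of the images is \<open>q z\<close> with \<open>z\<close> in
  \<open>D\<close>, exactly where \<open>inv_into D q\<close> undoes \<open>q\<close>.\<close>

lemma val_invertible_group_transformation:
  assumes "invertible_group_transformation G D q" and "x \<in> D" and "y \<in> D"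
    and "G \<subseteq> S \<or> G \<inter> S = {}"
  shows "val (q x) (q y) (f \<circ> inv_into D q) S = val x y f S"
  using inv_into_f_f[OF invertible_group_transformation_inj_on[OF assms(1)]
      invertible_group_transformation_hybrid(1)[OF assms]]
  by (simp add: val_def invertible_group_transformation_hybrid(2)[OF assms])

text \<open>Disjointness yields the dichotomy: the union contains \<open>B i\<close> or misses it
  according to whether \<open>i\<close> is in \<open>T\<close>. Since \<open>B\<close> is arbitrary
  outside \<open>I\<close>, \<open>T\<close> must stay inside \<open>I\<close>.\<close>

lemma group_val_invertible_group_transformation:
  assumes "disjoint_family_on B I" and "i \<in> I" and "T \<subseteq> I"
    and "invertible_group_transformation (B i) D q" and "x \<in> D" and "y \<in> D"
  shows "group_val B (q x) (q y) (f \<circ> inv_into D q) T = group_val B x y f T"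
proof -
  have "B i \<subseteq> (\<Union>k\<in>T. B k) \<or> B i \<inter> (\<Union>k\<in>T. B k) = {}"
  proof (cases "i \<in> T")
    case True
    then show ?thesis by blast
  next
    case False
    then have "B i \<inter> B k = {}" if "k \<in> T" for k
      using disjoint_family_onD[OF assms(1,2), of k] assms(3) that by blast
    then show ?thesis by blast
  qed
  then show ?thesis
    unfolding group_val_def
    by (rule val_invertible_group_transformation[OF assms(4-6)])
qed

theorem proposition4p3:
  fixes f :: "real ^ 'm::finite \<Rightarrow> real"
    and B :: "nat \<Rightarrow> 'm set"
    and l i k :: nat
    and D :: "(real ^ 'm) set"
    and q :: "real ^ 'm \<Rightarrow> real ^ 'm"
    and xbar x' :: "real ^ 'm"
  assumes "group_structure l B"
    and "ae_differentiable f"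
    and "i \<in> {1..l}"
    and "invertible_group_transformation (B i) D q"
    and "xbar \<in> D" and "x' \<in> D"
    and "k \<in> {1..l}"
  shows "GShap l B k xbar x' f = GShap l B k (q xbar) (q x') (f \<circ> inv_into D q)"
proof -
  have B: "disjoint_family_on B {1..l}"
    using assms(1) by (simp add: group_structure_def)
  \<comment> \<open>The transformed group \<open>i\<close> and the attributed group \<open>k\<close>
    are independent. The open premise \<open>T \<subseteq> {1..l}\<close> is met below by both
    coalitions of each summand.\<close>
  note group_val_eq =
    group_val_invertible_group_transformation[OF B assms(3) _ assms(4,5,6)]
  show ?thesis
    unfolding GShap_def
  proof (rule sum.cong[OF refl])
    fix T assume "T \<in> Pow ({1..l} - {k})"
    then have "T \<subseteq> {1..l}" and "T \<union> {k} \<subseteq> {1..l}"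
      using assms(7) by auto
    then show "fact (card T) * fact (l - card T - 1) / fact l *
        (group_val B xbar x' f (T \<union> {k}) - group_val B xbar x' f T) =
      fact (card T) * fact (l - card T - 1) / fact l *
        (group_val B (q xbar) (q x') (f \<circ> inv_into D q) (T \<union> {k}) -
         group_val B (q xbar) (q x') (f \<circ> inv_into D q) T)"
      by (simp only: group_val_eq)
  qed
qed

end
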